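(* Let $G$ and $H$ be two disjoint graphs. Let $\emptyset\neq X_i\subseteq V(G)$ for $i=1,2,\ldots,k$ and $\emptyset\neq Y_j\subseteq V(H)$ for $j=1,2,\ldots,l$, with $|X_1|=|Y_1|$, and let $G\cdot_{X_1Y_1}H$ be the vertex-set coalescence of $G$ and $H$ via $X_1$ and $Y_1$. Then $\{X_1,X_2,\ldots,X_k\}$ and $\{Y_1,Y_2,\ldots,Y_l\}$ are strong critical vertex-sets partitions of $G$ and $H$, respectively, if and only if $\{X_1,X_2,\ldots,X_k,Y_2,Y_3,\ldots,Y_l\}$ is a strong critical vertex-sets partition of $G\cdot_{X_1Y_1}H$.
   Context: All graphs are finite, undirected and simple; two graphs are disjoint if they have no common vertices. A set $D\subseteq V(G)$ is a dominating set of $G$ if every vertex of $G$ is in $D$ or adjacent to a vertex of $D$; the domination number $\gamma(G)$ is the minimum cardinality of a dominating set of $G$ (with the convention that the graph with no vertices has domination number $0$). For $S\subseteq V(G)$, $G-S$ denotes the graph obtained from $G$ by deleting the vertices of $S$. A set $S\subseteq V(G)$ is a strong critical vertex-set of $G$ if $\gamma(G-S)=\gamma(G)-|S|$. A strong critical vertex-sets partition of $G$ is a partition $\{S_1,\ldots,S_l\}$ of $V(G)$ in which every $S_i$ is a non-empty strong critical vertex-set of $G$. Vertex-set coalescence: let $X=\{x_1,\ldots,x_m\}\subseteq V(G)$ and $Y=\{y_1,\ldots,y_m\}\subseteq V(H)$ be non-empty sets of the same cardinality $m$, with fixed enumerations. $G\cdot_{XY}H$ is the graph obtained from the union $G\cup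 H$ by identifying, for every $1\le i\le m$, the vertices $x_i$ and $y_i$ as one vertex, named $x_i$ (the result is regarded as a simple graph, so parallel edges are merged). Thus $V(G\cdot_{XY}H)=V(G)\cup(V(H)\setminus Y)$; the vertices of $Y$ are replaced by those of $X$. *)

theory Defs
  imports
    "Graph_Theory.Pair_Digraph"
    "Graph_Theory.Digraph_Component"
    "HOL-Library.Disjoint_Sets"
begin

text \<open>
  Finite simple undirected graphs are the symmetric loop-free finite digraphs without parallel arcs
  of \<^locale>\<open>pair_graph\<close>: an edge \<open>uv\<close> is the pair of arcs \<open>(u, v)\<close>, \<open>(v, u)\<close>.
\<close>

definition dominating_set :: "('a, 'b) pre_digraph \<Rightarrow> 'a set \<Rightarrow> bool" where
  "dominating_set G D \<longleftrightarrow>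
     D \<subseteq> verts G \<and> (\<forall>v \<in> verts G. v \<in> D \<or> (\<exists>u \<in> D. u \<rightarrow>\<^bsub>G\<^esub> v))"

definition domination_number :: "('a, 'b) pre_digraph \<Rightarrow> nat" where
  "domination_number G = Min (card ` {D. dominating_set G D})"

definition delete_verts :: "('a, 'b) pre_digraph \<Rightarrow> 'a set \<Rightarrow> ('a, 'b) pre_digraph" where
  "delete_verts G S = G \<restriction> (verts G - S)"

text \<open>The equation is stated over the integers because subtraction on \<^typ>\<open>nat\<close> truncates.\<close>

definition strong_critical_set :: "('a, 'b) pre_digraph \<Rightarrow> 'a set \<Rightarrow> bool" where
  "strong_critical_set G S \<longleftrightarrow>
     S \<subseteq> verts G \<and>
     int (domination_number (delete_verts G S)) = int (domination_number G) - int (card S)"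

text \<open>
  The partition is given as a listing \<open>(S i)\<close>, \<open>i \<in> I\<close>, of its blocks without repetition;
  nonemptiness of the blocks is part of \<^const>\<open>partition_on\<close>.
\<close>

definition strong_critical_partition ::
    "('a, 'b) pre_digraph \<Rightarrow> 'i set \<Rightarrow> ('i \<Rightarrow> 'a set) \<Rightarrow> bool" where
  "strong_critical_partition G I S \<longleftrightarrow>
     inj_on S I \<and> partition_on (verts G) (S ` I) \<and> (\<forall>i \<in> I. strong_critical_set G (S i))"

text \<open>
  The coalescence of \<open>G\<close> and \<open>H\<close> via \<open>X = {x 1, \<dots>, x m}\<close> and \<open>Y = {y 1, \<dots>, y m}\<close>.
  The vertex \<open>y i\<close> is renamed to \<open>x i\<close>; arcs being a set of pairs, parallel ones merge.
  Meaningful when \<open>x\<close> and \<open>y\<close> are injective on \<open>{1..m}\<close> and \<open>G\<close>, \<open>H\<close> are disjoint.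
\<close>

definition identify :: "nat \<Rightarrow> (nat \<Rightarrow> 'a) \<Rightarrow> (nat \<Rightarrow> 'a) \<Rightarrow> 'a \<Rightarrow> 'a" where
  "identify m x y v = (if v \<in> y ` {1..m} then x (the_inv_into {1..m} y v) else v)"

definition coalescence ::
    "nat \<Rightarrow> (nat \<Rightarrow> 'a) \<Rightarrow> (nat \<Rightarrow> 'a) \<Rightarrow> 'a pair_pre_digraph \<Rightarrow> 'a pair_pre_digraph \<Rightarrow> 'a pair_pre_digraph"
  where
  "coalescence m x y G H = \<lparr>
     pverts = pverts G \<union> (pverts H - y ` {1..m}),
     parcs = parcs G \<union> map_prod (identify m x y) (identify m x y) ` parcs H \<rparr>"

end

theory Submission
  imports Defs
begin

text \<open>
  The theorem rests on three inequalities for the domination number \<open>\<gamma>\<close>. Deleting \<open>S\<close> lowers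
  \<open>\<gamma>\<close> by at most \<open>|S|\<close>, since \<open>S\<close> may be added to any dominating set of \<open>G - S\<close>; so being strong
  critical means attaining an extreme value, and only one inequality has to be checked. Dominating
  sets of two subgraphs covering a graph unite to a dominating set of the graph
  (\<open>gamma_Un_le\<close>). Finally, when \<open>C\<close> arises by gluing \<open>G\<close> and \<open>H\<close> along \<open>X\<close>, then
  \<open>\<gamma>(G) + \<gamma>(H) \<le> \<gamma>(C) + |X|\<close> (\<open>gamma_add_le\<close>).

  These give first (\<open>critical_shared_iff\<close>) that \<open>X\<close> is strong critical in \<open>C\<close> exactly if it is
  so in both \<open>G\<close> and \<open>H\<close>: \<open>C - X\<close> is the disjoint union of \<open>G - X\<close> and \<open>H - X\<close>, and the bound
  \<open>\<gamma>(C) \<le> \<gamma>(G) + \<gamma>(H - X)\<close> lets criticality in \<open>C\<close> pass to \<open>G\<close>. Suppose now that \<open>X\<close> is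
  strong critical in these graphs; then \<open>\<gamma>(C) = \<gamma>(G) + \<gamma>(H) - |X|\<close>. For a set \<open>S\<close> of
  vertices of \<open>G\<close> away from \<open>X\<close>, the graph \<open>C - S\<close> is \<open>G - S\<close> glued to \<open>H\<close> along \<open>X\<close>, and the same inequalities squeeze \<open>\<gamma>(C - S)\<close> to
  \<open>\<gamma>(G - S) + \<gamma>(H) - |X|\<close>, so that \<open>S\<close> is strong critical in \<open>C\<close> exactly if it is in \<open>G\<close>
  (\<open>critical_left_iff\<close>); sets on the side of \<open>H\<close> are symmetric.
  What is left is bookkeeping: the renaming of \<open>Y\<close> to \<open>X\<close> in \<open>H\<close> is an isomorphism, and the
  blocks partition \<open>V(C)\<close> exactly if they partition \<open>V(G)\<close> and \<open>V(H)\<close>.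
\<close>

section \<open>Domination in induced subgraphs\<close>

text \<open>
  A dominating set of the subgraph induced by \<open>V\<close> lies within \<open>V\<close>, so it can be described by
  an arc relation \<open>E\<close> on a larger set of vertices. Keeping \<open>E\<close> fixed while \<open>V\<close> shrinks makes
  deletion of vertices a set difference.
\<close>

definition dominates_in :: "('a \<times> 'a) set \<Rightarrow> 'a set \<Rightarrow> 'a set \<Rightarrow> bool" where
  "dominates_in E V D \<longleftrightarrow> D \<subseteq> V \<and> (\<forall>v\<in>V. v \<in> D \<or> (\<exists>u\<in>D. (u, v) \<in> E))"

definition gamma :: "('a \<times> 'a) set \<Rightarrow> 'a set \<Rightarrow> nat" where
  "gamma E V = Min (card ` {D. dominates_in E V D})"

definition critical :: "('a \<times> 'a) set \<Rightarrow> 'a set \<Rightarrow> 'a set \<Rightarrow> bool" where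
  "critical E V S \<longleftrightarrow> gamma E (V - S) + card S = gamma E V"

lemma finite_dominates_in:
  assumes "finite V"
  shows "finite {D. dominates_in E V D}"
  by (rule finite_subset[of _ "Pow V"]) (use assms in \<open>auto simp: dominates_in_def\<close>)

lemma gamma_le:
  assumes "finite V" "dominates_in E V D"
  shows "gamma E V \<le> card D"
  unfolding gamma_def using assms finite_dominates_in[OF assms(1)] by (intro Min_le) auto

lemma gamma_attained:
  assumes "finite V"
  obtains D where "dominates_in E V D" "card D = gamma E V" "finite D"
proof -
  have "dominates_in E V V" by (auto simp: dominates_in_def)
  then have "Min (card ` {D. dominates_in E V D}) \<in> card ` {D. dominates_in E V D}"
    using finite_dominates_in[OF assms] by (intro Min_in) auto
  then obtain D where D: "dominates_in E V D" "card D = gamma E V" by (auto simp: gamma_def)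
  moreover have "finite D" using D(1) assms finite_subset by (auto simp: dominates_in_def)
  ultimately show thesis using that by blast
qed

lemma domination_number_delete_verts:
  assumes "pair_wf_digraph G"
  shows "domination_number (delete_verts (with_proj G) S) = gamma (parcs G) (pverts G - S)"
proof -
  have "dominating_set (delete_verts (with_proj G) S) D \<longleftrightarrow> dominates_in (parcs G) (pverts G - S) D" for D
    unfolding dominating_set_def dominates_in_def delete_verts_def arcs_ends_conv
    by (force simp: induce_subgraph_def)
  then show ?thesis by (simp add: domination_number_def gamma_def)
qed

lemma domination_number_with_proj: "domination_number (with_proj G) = gamma (parcs G) (pverts G)"
  by (simp add: domination_number_def gamma_def dominating_set_def dominates_in_def arcs_ends_conv)

lemma strong_critical_set_iff_critical:
  assumes "pair_wf_digraph G"
  shows "strong_critical_set (with_proj G) S \<longleftrightarrow> S \<subseteq> pverts G \<and> critical (parcs G) (pverts G) S"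
  unfolding strong_critical_set_def critical_def
    domination_number_delete_verts[OF assms] domination_number_with_proj
  by auto

lemma gamma_Un_le:
  assumes "finite U" "finite W"
  shows "gamma (E \<union> F) (U \<union> W) \<le> gamma E U + gamma F W"
proof -
  obtain D where D: "dominates_in E U D" "card D = gamma E U" using gamma_attained[OF assms(1)] .
  obtain D' where D': "dominates_in F W D'" "card D' = gamma F W" using gamma_attained[OF assms(2)] .
  have "dominates_in (E \<union> F) (U \<union> W) (D \<union> D')" using D(1) D'(1) by (auto simp: dominates_in_def)
  then have "gamma (E \<union> F) (U \<union> W) \<le> card (D \<union> D')" using assms by (simp add: gamma_le)
  also have "\<dots> \<le> gamma E U + gamma F W" using card_Un_le[of D D'] D(2) D'(2) by simp
  finally show ?thesis .
qed

lemma gamma_le_gamma_delete: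
  assumes "finite V" "S \<subseteq> V"
  shows "gamma E V \<le> gamma E (V - S) + card S"
proof -
  have S: "finite S" using assms finite_subset by blast
  have "gamma E S \<le> card S" by (rule gamma_le[OF S]) (auto simp: dominates_in_def)
  moreover have "V - S \<union> S = V" using assms by blast
  ultimately show ?thesis using gamma_Un_le[of "V - S" S E E] assms S by simp
qed

lemma critical_iff_le:
  assumes "finite V" "S \<subseteq> V"
  shows "critical E V S \<longleftrightarrow> gamma E (V - S) + card S \<le> gamma E V"
  using gamma_le_gamma_delete[OF assms, of E] by (auto simp: critical_def)

section \<open>Isomorphism invariance\<close>

lemma gamma_image:
  assumes "inj_on f B" "E \<subseteq> B \<times> B" "V \<subseteq> B"
  shows "gamma (map_prod f f ` E) (f ` V) = gamma E V"
proof -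
  define E' where "E' = map_prod f f ` E"
  have arc: "(f u, f v) \<in> E' \<longleftrightarrow> (u, v) \<in> E" if "u \<in> V" "v \<in> V" for u v
  proof
    assume "(f u, f v) \<in> E'"
    then obtain a b where ab: "(a, b) \<in> E" "f u = f a" "f v = f b" by (auto simp: E'_def)
    then have "a \<in> B" "b \<in> B" "u \<in> B" "v \<in> B" using that assms(2,3) by blast+
    then have "u = a" "v = b" using ab(2,3) inj_onD[OF assms(1)] by blast+
    then show "(u, v) \<in> E" using ab(1) by simp
  next
    assume "(u, v) \<in> E"
    then show "(f u, f v) \<in> E'" unfolding E'_def by (rule map_prod_imageI)
  qed
  have inj: "inj_on f V" using assms(1,3) by (rule inj_on_subset)
  have iff: "dominates_in E' (f ` V) (f ` D) \<longleftrightarrow> dominates_in E V D" if D: "D \<subseteq> V" for D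
  proof -
    have "f v \<in> f ` D \<longleftrightarrow> v \<in> D" if "v \<in> V" for v
      using inj_on_image_mem_iff[OF inj that D] .
    moreover have "(\<exists>u\<in>D. (f u, f v) \<in> E') \<longleftrightarrow> (\<exists>u\<in>D. (u, v) \<in> E)" if "v \<in> V" for v
      using arc that D by blast
    ultimately show ?thesis using D by (simp add: dominates_in_def image_mono)
  qed
  have "{D. dominates_in E' (f ` V) D} = (`) f ` {D. dominates_in E V D}"
  proof (intro equalityI subsetI)
    fix D assume D: "D \<in> {D. dominates_in E' (f ` V) D}"
    then obtain D' where "D' \<subseteq> V" "D = f ` D'"
      by (auto simp: dominates_in_def subset_image_iff)
    then show "D \<in> (`) f ` {D. dominates_in E V D}" using iff D by auto
  next
    fix D assume "D \<in> (`) f ` {D. dominates_in E V D}"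
    then obtain D' where "dominates_in E V D'" "D = f ` D'" by blast
    then show "D \<in> {D. dominates_in E' (f ` V) D}"
      using iff[of D'] by (auto simp: dominates_in_def)
  qed
  moreover have "card (f ` D) = card D" if "dominates_in E V D" for D
    using that inj by (meson card_image dominates_in_def inj_on_subset)
  then have "card ` (`) f ` {D. dominates_in E V D} = card ` {D. dominates_in E V D}"
    unfolding image_image by (intro image_cong) auto
  ultimately have "gamma E' (f ` V) = gamma E V" by (simp only: gamma_def)
  then show ?thesis by (simp add: E'_def)
qed

lemma critical_image:
  assumes "inj_on f B" "E \<subseteq> B \<times> B" "S \<subseteq> B"
  shows "critical (map_prod f f ` E) (f ` B) (f ` S) \<longleftrightarrow> critical E B S"
proof -
  have "f ` B - f ` S = f ` (B - S)" using assms by (simp add: inj_on_image_set_diff[OF assms(1)])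
  moreover have "card (f ` S) = card S" using assms by (meson card_image inj_on_subset)
  ultimately show ?thesis using assms by (simp add: critical_def gamma_image[OF assms(1,2)])
qed

section \<open>Gluing two graphs along their common vertices\<close>

locale glued_graphs =
  fixes A B :: "'a set" and E F :: "('a \<times> 'a) set"
  assumes fin: "finite A" "finite B"
    and arcs: "E \<subseteq> A \<times> A" "F \<subseteq> B \<times> B"
begin

lemma glued_graphs_commute: "glued_graphs B A F E"
  using fin arcs by unfold_locales

text \<open>
  Split a dominating set \<open>D\<close> of the glued graph into its traces on the two sides. A shared vertex
  may be dominated from one side only, and then has to be added on the other. Each shared vertex
  causes at most one unit of excess: those in \<open>D\<close> are counted in both traces but are never added,
  and no vertex is added on both sides. Both sides must keep the
  same shared vertices, since otherwise a vertex kept on one side only could be dominated by an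
  arc of the other side.
\<close>

lemma gamma_add_le:
  assumes U: "U \<subseteq> A" and W: "W \<subseteq> B" and shared: "U \<inter> B = W \<inter> A"
  shows "gamma E U + gamma F W \<le> gamma (E \<union> F) (U \<union> W) + card (U \<inter> W)"
proof -
  have finUW: "finite U" "finite W" using U W fin finite_subset by blast+
  obtain D where D: "dominates_in (E \<union> F) (U \<union> W) D" "card D = gamma (E \<union> F) (U \<union> W)" "finite D"
    using gamma_attained[of "U \<union> W"] finUW by blast
  define P where "P = {v \<in> U \<inter> W. v \<notin> D \<and> (\<forall>u\<in>D \<inter> U. (u, v) \<notin> E)}"
  define Q where "Q = {v \<in> U \<inter> W. v \<notin> D \<and> (\<forall>u\<in>D \<inter> W. (u, v) \<notin> F)}"
  have sub: "D \<subseteq> U \<union> W" using D(1) by (simp add: dominates_in_def)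
  have dom: "v \<in> D \<or> (\<exists>u\<in>D \<inter> U. (u, v) \<in> E) \<or> (\<exists>u\<in>D \<inter> W. (u, v) \<in> F)" if "v \<in> U \<union> W" for v
  proof -
    have "v \<in> D \<or> (\<exists>u\<in>D. (u, v) \<in> E \<union> F)" using D(1) that by (simp add: dominates_in_def)
    then consider "v \<in> D" | u where "u \<in> D" "(u, v) \<in> E" | u where "u \<in> D" "(u, v) \<in> F"
      by blast
    then show ?thesis
    proof cases
      case 2
      then have "u \<in> A" "u \<in> U \<or> u \<in> W" using arcs(1) sub by blast+
      then have "u \<in> U" using shared by blast
      with 2 show ?thesis by blast
    next
      case 3
      then have "u \<in> B" "u \<in> U \<or> u \<in> W" using arcs(2) sub by blast+
      then have "u \<in> W" using shared by blast
      with 3 show ?thesis by blast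
    qed simp
  qed
  have "v \<in> (D \<inter> U) \<union> P \<or> (\<exists>u\<in>(D \<inter> U) \<union> P. (u, v) \<in> E)" if v: "v \<in> U" for v
  proof (cases "v \<in> W")
    case True
    then show ?thesis using v by (auto simp: P_def)
  next
    case False
    \<comment> \<open>an arc of \<open>F\<close> would make \<open>v\<close> a shared vertex\<close>
    then have "v \<notin> B" using v shared by blast
    then have "\<And>u. (u, v) \<notin> F" using arcs(2) by blast
    then show ?thesis using dom[of v] v by auto
  qed
  then have "dominates_in E U ((D \<inter> U) \<union> P)" by (auto simp: dominates_in_def P_def)
  then have "gamma E U \<le> card ((D \<inter> U) \<union> P)" by (rule gamma_le[OF finUW(1)])
  also have "\<dots> \<le> card (D \<inter> U) + card P" by (rule card_Un_le)
  finally have leU: "gamma E U \<le> card (D \<inter> U) + card P" .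
  have "v \<in> (D \<inter> W) \<union> Q \<or> (\<exists>u\<in>(D \<inter> W) \<union> Q. (u, v) \<in> F)" if v: "v \<in> W" for v
  proof (cases "v \<in> U")
    case True
    then show ?thesis using v by (auto simp: Q_def)
  next
    case False
    then have "v \<notin> A" using v shared by blast
    then have "\<And>u. (u, v) \<notin> E" using arcs(1) by blast
    then show ?thesis using dom[of v] v by auto
  qed
  then have "dominates_in F W ((D \<inter> W) \<union> Q)" by (auto simp: dominates_in_def Q_def)
  then have "gamma F W \<le> card ((D \<inter> W) \<union> Q)" by (rule gamma_le[OF finUW(2)])
  also have "\<dots> \<le> card (D \<inter> W) + card Q" by (rule card_Un_le)
  finally have leW: "gamma F W \<le> card (D \<inter> W) + card Q" .
  have finPQ: "finite P" "finite Q" using finUW by (auto simp: P_def Q_def)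
  have "P \<inter> Q = {}" using dom by (fastforce simp: P_def Q_def)
  then have "card P + card Q = card (P \<union> Q)" using finPQ by (simp add: card_Un_disjoint)
  moreover have "card (D \<inter> U \<inter> W) + card (P \<union> Q) = card ((D \<inter> U \<inter> W) \<union> (P \<union> Q))"
    using finPQ D(3) by (intro card_Un_disjoint[symmetric]) (auto simp: P_def Q_def)
  moreover have "\<dots> \<le> card (U \<inter> W)"
    using finUW by (intro card_mono) (auto simp: P_def Q_def)
  moreover have "card (D \<inter> U) + card (D \<inter> W) = card D + card (D \<inter> U \<inter> W)"
  proof -
    have "(D \<inter> U) \<union> (D \<inter> W) = D" "(D \<inter> U) \<inter> (D \<inter> W) = D \<inter> U \<inter> W" using sub by auto
    then show ?thesis using card_Un_Int[of "D \<inter> U" "D \<inter> W"] D(3) by simp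
  qed
  ultimately show ?thesis using leU leW D(2) by linarith
qed

text \<open>
  Without the shared vertices the two sides fall apart: the pieces have no vertex in common, so
  the correction term of \<open>gamma_add_le\<close> vanishes.
\<close>

lemma gamma_delete_shared:
  "gamma (E \<union> F) (A \<union> B - A \<inter> B) = gamma E (A - A \<inter> B) + gamma F (B - A \<inter> B)"
proof -
  have "A \<union> B - A \<inter> B = (A - A \<inter> B) \<union> (B - A \<inter> B)" by blast
  moreover have "(A - A \<inter> B) \<inter> (B - A \<inter> B) = {}" by blast
  moreover have "(A - A \<inter> B) \<inter> B = (B - A \<inter> B) \<inter> A" by blast
  ultimately show ?thesis
    using gamma_add_le[of "A - A \<inter> B" "B - A \<inter> B"] gamma_Un_le[of "A - A \<inter> B" "B - A \<inter> B" E F] fin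
    by simp
qed

text \<open>
  A dominating set on \<open>U\<close> takes care of all shared vertices as well, so on the right only the
  others remain to be dominated.
\<close>

lemma gamma_le_gamma_delete_right:
  assumes "A \<inter> B \<subseteq> U" "U \<subseteq> A"
  shows "gamma (E \<union> F) (U \<union> B) \<le> gamma E U + gamma F (B - A \<inter> B)"
proof -
  have "U \<union> B = U \<union> (B - A \<inter> B)" using assms by blast
  then show ?thesis
    using gamma_Un_le[of U "B - A \<inter> B" E F] fin assms(2) finite_subset by auto
qed

text \<open>
  Deleting the shared vertices lowers \<open>\<gamma>\<close> of the glued graph by their full number, and the
  decomposition of what remains lets \<open>\<gamma>\<close> of the right-hand remainder cancel.
\<close>

lemma critical_shared_imp_left:
  assumes "critical (E \<union> F) (A \<union> B) (A \<inter> B)"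
  shows "critical E A (A \<inter> B)"
proof -
  have "gamma (E \<union> F) (A \<union> B) \<le> gamma E A + gamma F (B - A \<inter> B)"
    by (rule gamma_le_gamma_delete_right) auto
  then have "gamma E (A - A \<inter> B) + card (A \<inter> B) \<le> gamma E A"
    using assms by (simp add: critical_def gamma_delete_shared)
  then show ?thesis using fin by (simp add: critical_iff_le)
qed

lemma critical_shared_iff:
  "critical (E \<union> F) (A \<union> B) (A \<inter> B) \<longleftrightarrow> critical E A (A \<inter> B) \<and> critical F B (A \<inter> B)"
proof (intro iffI conjI)
  assume C: "critical (E \<union> F) (A \<union> B) (A \<inter> B)"
  then show "critical E A (A \<inter> B)" by (rule critical_shared_imp_left)
  interpret swap: glued_graphs B A F E by (rule glued_graphs_commute)
  show "critical F B (A \<inter> B)" using swap.critical_shared_imp_left C by (simp add: Un_commute Int_commute)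
next
  assume "critical E A (A \<inter> B) \<and> critical F B (A \<inter> B)"
  then have "gamma E A = gamma E (A - A \<inter> B) + card (A \<inter> B)"
    "gamma F B = gamma F (B - A \<inter> B) + card (A \<inter> B)" by (simp_all add: critical_def)
  moreover have "gamma E A + gamma F B \<le> gamma (E \<union> F) (A \<union> B) + card (A \<inter> B)"
    by (rule gamma_add_le) auto
  ultimately have "gamma (E \<union> F) (A \<union> B - A \<inter> B) + card (A \<inter> B) \<le> gamma (E \<union> F) (A \<union> B)"
    by (simp add: gamma_delete_shared)
  moreover have "A \<inter> B \<subseteq> A \<union> B" by blast
  ultimately show "critical (E \<union> F) (A \<union> B) (A \<inter> B)" using fin by (simp add: critical_iff_le)
qed

text \<open>
  When the shared vertices form a critical set of the right-hand graph, the lower bound of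
  \<open>gamma_add_le\<close> and the upper bound of \<open>gamma_le_gamma_delete_right\<close> coincide. Gluing the
  right-hand graph then shifts \<open>\<gamma>\<close> by the same amount for every \<open>U\<close>, so differences of \<open>\<gamma>\<close>
  on the left are preserved.
\<close>

lemma gamma_glued:
  assumes "critical F B (A \<inter> B)" "A \<inter> B \<subseteq> U" "U \<subseteq> A"
  shows "gamma (E \<union> F) (U \<union> B) = gamma E U + gamma F (B - A \<inter> B)"
proof (rule antisym)
  show "gamma (E \<union> F) (U \<union> B) \<le> gamma E U + gamma F (B - A \<inter> B)"
    by (rule gamma_le_gamma_delete_right[OF assms(2,3)])
  have "U \<inter> B = A \<inter> B" using assms(2,3) by blast
  then have "gamma E U + gamma F B \<le> gamma (E \<union> F) (U \<union> B) + card (A \<inter> B)"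
    using gamma_add_le[of U B] assms(3) by (simp add: Int_commute)
  then show "gamma E U + gamma F (B - A \<inter> B) \<le> gamma (E \<union> F) (U \<union> B)"
    using assms(1) by (simp add: critical_def)
qed

lemma critical_left_iff:
  assumes "critical F B (A \<inter> B)" "S \<subseteq> A" "S \<inter> B = {}"
  shows "critical (E \<union> F) (A \<union> B) S \<longleftrightarrow> critical E A S"
proof -
  have "A \<union> B - S = (A - S) \<union> B" using assms by blast
  moreover have "A \<inter> B \<subseteq> A - S" using assms by blast
  ultimately show ?thesis using assms(1) gamma_glued[of "A - S"] gamma_glued[of A]
    by (auto simp: critical_def)
qed

lemma critical_right_iff:
  assumes "critical E A (A \<inter> B)" "S \<subseteq> B" "S \<inter> A = {}"
  shows "critical (E \<union> F) (A \<union> B) S \<longleftrightarrow> critical F B S"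
proof -
  interpret swap: glued_graphs B A F E by (rule glued_graphs_commute)
  show ?thesis using swap.critical_left_iff assms by (simp add: Un_commute Int_commute)
qed

end

section \<open>Coalescence as gluing\<close>

lemma identify_simps:
  assumes "inj_on y {1..m}"
  shows "i \<in> {1..m} \<Longrightarrow> identify m x y (y i) = x i"
    and "v \<notin> y ` {1..m} \<Longrightarrow> identify m x y v = v"
  using the_inv_into_f_f[OF assms] by (auto simp: identify_def)

lemma identify_image_Y:
  assumes "inj_on y {1..m}"
  shows "identify m x y ` y ` {1..m} = x ` {1..m}"
  unfolding image_image by (rule image_cong[OF refl]) (rule identify_simps(1)[OF assms])

lemma identify_image_disjoint:
  assumes "S \<inter> y ` {1..m} = {}"
  shows "identify m x y ` S = S"
proof -
  have "identify m x y v = v" if "v \<in> S" for v using that assms by (auto simp: identify_def)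
  then show ?thesis by simp
qed

text \<open>
  No renamed vertex can collide with one that keeps its name, because the new names do not occur
  in \<open>V\<close>. In the coalescence, \<open>V\<close> is \<open>V(H)\<close> and the new names are vertices of \<open>G\<close>.
\<close>

lemma inj_on_identify:
  assumes "inj_on x {1..m}" "inj_on y {1..m}" "x ` {1..m} \<inter> V = {}"
  shows "inj_on (identify m x y) V"
proof -
  have "inj_on (identify m x y) (V \<inter> y ` {1..m})"
  proof (rule inj_onI)
    fix u v
    assume "u \<in> V \<inter> y ` {1..m}" "v \<in> V \<inter> y ` {1..m}" and eq: "identify m x y u = identify m x y v"
    then obtain i j where ij: "i \<in> {1..m}" "u = y i" "j \<in> {1..m}" "v = y j" by blast
    then have "x i = x j" using eq identify_simps(1)[OF assms(2), of _ x] by metis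
    then show "u = v" using ij inj_onD[OF assms(1)] by blast
  qed
  moreover have "inj_on (identify m x y) (V - y ` {1..m})"
    by (auto simp: identify_def inj_on_def)
  moreover have "identify m x y ` (V \<inter> y ` {1..m}) \<subseteq> x ` {1..m}"
    using identify_image_Y[OF assms(2)] by blast
  moreover have "identify m x y ` (V - y ` {1..m}) \<subseteq> V"
    by (auto simp: identify_def)
  ultimately have "inj_on (identify m x y) ((V \<inter> y ` {1..m}) \<union> (V - y ` {1..m}))"
    using assms(3) by (subst inj_on_Un) blast
  then show ?thesis by (simp add: Int_Diff_Un)
qed

section \<open>Indexed partitions\<close>

lemma partition_on_image_iff:
  assumes "\<And>i. i \<in> I \<Longrightarrow> S i \<noteq> {}"
  shows "inj_on S I \<and> partition_on V (S ` I) \<longleftrightarrow> \<Union>(S ` I) = V \<and> disjoint_family_on S I"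
proof -
  have inj: "inj_on S I" if "disjoint_family_on S I"
    using that assms by (fastforce simp: inj_on_def disjoint_family_on_def)
  have "disjoint_family_on S I \<longleftrightarrow> inj_on S I \<and> disjoint (S ` I)"
  proof (intro iffI conjI)
    assume "inj_on S I \<and> disjoint (S ` I)"
    then show "disjoint_family_on S I"
      unfolding disjoint_family_on_def disjoint_def by (meson image_eqI inj_onD)
  next
    assume *: "disjoint_family_on S I"
    then show "inj_on S I" by (rule inj)
    show "disjoint (S ` I)" using * by (rule disjoint_family_on_disjoint_image)
  qed
  then show ?thesis using assms by (auto simp: partition_on_def)
qed

text \<open>
  For a listing of nonempty sets, being pairwise disjoint already excludes repetitions. A union
  and a disjoint family are easier to split over a sum of index sets than a set of blocks.
\<close>

lemma strong_critical_partition_iff: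
  assumes "pair_wf_digraph G" and ne: "\<And>i. i \<in> I \<Longrightarrow> S i \<noteq> {}"
  shows "strong_critical_partition (with_proj G) I S \<longleftrightarrow>
    (\<Union>(S ` I) = pverts G \<and> disjoint_family_on S I) \<and>
    (\<forall>i\<in>I. critical (parcs G) (pverts G) (S i))"
proof -
  have "inj_on S I \<and> partition_on (pverts G) (S ` I) \<longleftrightarrow>
      \<Union>(S ` I) = pverts G \<and> disjoint_family_on S I"
    by (rule partition_on_image_iff) (rule ne)
  moreover have "S i \<subseteq> pverts G" if "\<Union>(S ` I) = pverts G" "i \<in> I" for i
    using that by blast
  ultimately show ?thesis
    unfolding strong_critical_partition_def strong_critical_set_iff_critical[OF assms(1)]
      with_proj_simps by meson
qed

lemma disjoint_family_on_Plus:
  "disjoint_family_on (case_sum X Y) (I <+> J) \<longleftrightarrow>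
     disjoint_family_on X I \<and> disjoint_family_on Y J \<and> \<Union>(X ` I) \<inter> \<Union>(Y ` J) = {}"
  (is "?L \<longleftrightarrow> ?X \<and> ?Y \<and> ?D")
proof
  assume L: ?L
  have "X i \<inter> X i' = {}" if "i \<in> I" "i' \<in> I" "i \<noteq> i'" for i i'
    using disjoint_family_onD[OF L, of "Inl i" "Inl i'"] that by (simp add: InlI InrI)
  moreover have "Y j \<inter> Y j' = {}" if "j \<in> J" "j' \<in> J" "j \<noteq> j'" for j j'
    using disjoint_family_onD[OF L, of "Inr j" "Inr j'"] that by (simp add: InlI InrI)
  moreover have "X i \<inter> Y j = {}" if "i \<in> I" "j \<in> J" for i j
    using disjoint_family_onD[OF L, of "Inl i" "Inr j"] that by (simp add: InlI InrI)
  ultimately show "?X \<and> ?Y \<and> ?D" unfolding disjoint_family_on_def by blast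
next
  assume R: "?X \<and> ?Y \<and> ?D"
  then have XY: "X i \<inter> Y j = {}" "Y j \<inter> X i = {}" if "i \<in> I" "j \<in> J" for i j
    using that by blast+
  show ?L
    unfolding disjoint_family_on_def
  proof (intro ballI impI)
    fix s t assume "s \<in> I <+> J" "t \<in> I <+> J" "s \<noteq> t"
    then show "case_sum X Y s \<inter> case_sum X Y t = {}"
      using R XY by (elim PlusE) (simp_all add: disjoint_family_on_def)
  qed
qed

text \<open>
  With \<open>A = V(G)\<close> and \<open>B = V(H)\<close>, the block \<open>Y j0\<close> is the part of \<open>V(H)\<close> that the coalescence
  absorbs into \<open>V(G)\<close>. Since \<open>A\<close> and \<open>B\<close> are disjoint, intersecting a covering of
  \<open>A \<union> (B - Y j0)\<close> with \<open>A\<close> and with \<open>B\<close> separates the two kinds of blocks; the blocks other than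
  \<open>Y j0\<close> cover exactly \<open>B - Y j0\<close>, so that they are disjoint from it.
\<close>

lemma partition_Plus_iff:
  assumes "A \<inter> B = {}" "\<And>i. i \<in> I \<Longrightarrow> X i \<subseteq> A" "\<And>j. j \<in> insert j0 J \<Longrightarrow> Y j \<subseteq> B" "j0 \<notin> J"
  shows "\<Union>(case_sum X Y ` (I <+> J)) = A \<union> (B - Y j0) \<and> disjoint_family_on (case_sum X Y) (I <+> J) \<longleftrightarrow>
    (\<Union>(X ` I) = A \<and> disjoint_family_on X I) \<and>
    (\<Union>(Y ` insert j0 J) = B \<and> disjoint_family_on Y (insert j0 J))"
proof -
  define P Q where "P = \<Union>(X ` I)" and "Q = \<Union>(Y ` J)"
  have *: "P \<subseteq> A" "Q \<subseteq> B" "Y j0 \<subseteq> B" using assms(2,3) by (auto simp: P_def Q_def)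
  have "\<Union>(case_sum X Y ` (I <+> J)) = P \<union> Q" by (auto simp: P_def Q_def Plus_def)
  moreover have "P \<union> Q = A \<union> (B - Y j0) \<longleftrightarrow> P = A \<and> Q = B - Y j0"
  proof
    assume eq: "P \<union> Q = A \<union> (B - Y j0)"
    have "P = (P \<union> Q) \<inter> A" "Q = (P \<union> Q) \<inter> B" using * assms(1) by blast+
    then show "P = A \<and> Q = B - Y j0" unfolding eq using assms(1) by blast
  qed simp
  moreover have "P \<inter> Q = {}" using * assms(1) by blast
  moreover have "disjoint_family_on Y (insert j0 J) \<longleftrightarrow> Y j0 \<inter> Q = {} \<and> disjoint_family_on Y J"
    using disjoint_family_on_insert[OF assms(4)] by (simp add: Q_def)
  moreover have "Q = B - Y j0 \<longleftrightarrow> Y j0 \<union> Q = B \<and> Y j0 \<inter> Q = {}"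
    using *(2,3) by blast
  moreover have "\<Union>(Y ` insert j0 J) = Y j0 \<union> Q" by (simp add: Q_def)
  ultimately show ?thesis unfolding disjoint_family_on_Plus P_def[symmetric] Q_def[symmetric] by metis
qed

section \<open>Strong critical partitions of a coalescence\<close>

theorem theorem2:
  fixes G H :: "'a pair_pre_digraph"
    and X Y :: "nat \<Rightarrow> 'a set"
    and x y :: "nat \<Rightarrow> 'a"
    and k l m :: nat
  assumes "pair_graph G" and "pair_graph H"
    and "pverts G \<inter> pverts H = {}"
    and "1 \<le> k" and "1 \<le> l"
    and "\<And>i. i \<in> {1..k} \<Longrightarrow> X i \<noteq> {} \<and> X i \<subseteq> pverts G"
    and "\<And>j. j \<in> {1..l} \<Longrightarrow> Y j \<noteq> {} \<and> Y j \<subseteq> pverts H"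
    and "card (X 1) = m" and "card (Y 1) = m"
    and "bij_betw x {1..m} (X 1)" and "bij_betw y {1..m} (Y 1)"
  shows "(strong_critical_partition (with_proj G) {1..k} X \<and>
          strong_critical_partition (with_proj H) {1..l} Y) \<longleftrightarrow>
         strong_critical_partition (with_proj (coalescence m x y G H))
           ({1..k} <+> {2..l}) (case_sum X Y)"
proof -
  interpret G: pair_graph G by fact
  interpret H: pair_graph H by fact
  define f where "f = identify m x y"
  \<comment> \<open>\<open>H\<close> with \<open>Y 1\<close> renamed to \<open>X 1\<close>\<close>
  define B where "B = f ` pverts H"
  define F where "F = map_prod f f ` parcs H"
  let ?A = "pverts G" and ?E = "parcs G" and ?C = "coalescence m x y G H"
  have xm: "x ` {1..m} = X 1" "inj_on x {1..m}" and ym: "y ` {1..m} = Y 1" "inj_on y {1..m}"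
    using assms(10,11) by (auto simp: bij_betw_def)
  have X1: "X 1 \<subseteq> ?A" and Y1: "Y 1 \<subseteq> pverts H" using assms(4-7) by auto
  have idx: "{1..l} = insert 1 {2..l}" using assms(5) by auto
  have X: "X i \<noteq> {}" "X i \<subseteq> ?A" if "i \<in> {1..k}" for i using assms(6)[OF that] by blast+
  have Y: "Y j \<noteq> {}" "Y j \<subseteq> pverts H" if "j \<in> insert 1 {2..l}" for j
    using assms(7)[of j] that unfolding idx by blast+
  have inj: "inj_on f (pverts H)"
    unfolding f_def by (rule inj_on_identify[OF xm(2) ym(2)]) (use xm(1) X1 assms(3) in blast)
  have fY: "f ` Y 1 = X 1" using identify_image_Y[OF ym(2)] xm(1) ym(1) by (simp add: f_def)
  have f_fix: "f ` S = S" if "S \<inter> Y 1 = {}" for S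
    unfolding f_def by (rule identify_image_disjoint) (unfold ym(1), rule that)
  have "pverts H = Y 1 \<union> (pverts H - Y 1)" using Y1 by blast
  then have "B = f ` Y 1 \<union> f ` (pverts H - Y 1)" unfolding B_def by (metis image_Un)
  moreover have "f ` (pverts H - Y 1) = pverts H - Y 1" by (rule f_fix) blast
  ultimately have B: "B = X 1 \<union> (pverts H - Y 1)" using fY by simp
  have parcsH: "parcs H \<subseteq> pverts H \<times> pverts H" using H.in_arcsD1 H.in_arcsD2 by auto
  interpret glued_graphs ?A B ?E F
  proof
    show "?E \<subseteq> ?A \<times> ?A" using G.in_arcsD1 G.in_arcsD2 by auto
    show "F \<subseteq> B \<times> B" using parcsH by (auto simp: F_def B_def)
  qed (simp_all add: B_def G.pair_finite_verts H.pair_finite_verts)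
  have shared: "?A \<inter> B = X 1" using B X1 assms(3) by blast
  have C: "pverts ?C = ?A \<union> (pverts H - Y 1)" "parcs ?C = ?E \<union> F"
    using ym(1) by (auto simp: coalescence_def F_def f_def)
  have AB: "pverts ?C = ?A \<union> B" using B C(1) X1 by auto
  have wfC: "pair_wf_digraph ?C"
  proof
    show "fst e \<in> pverts ?C" "snd e \<in> pverts ?C" if "e \<in> parcs ?C" for e
      using that arcs unfolding AB C(2) by auto
  qed
  let ?part = "(\<Union>(X ` {1..k}) = ?A \<and> disjoint_family_on X {1..k}) \<and>
    (\<Union>(Y ` {1..l}) = pverts H \<and> disjoint_family_on Y {1..l})"
  have spG: "strong_critical_partition (with_proj G) {1..k} X \<longleftrightarrow>
      (\<Union>(X ` {1..k}) = ?A \<and> disjoint_family_on X {1..k}) \<and> (\<forall>i\<in>{1..k}. critical ?E ?A (X i))"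
    by (rule strong_critical_partition_iff[OF G.pair_wf_digraph_axioms]) (use assms(6) in blast)
  have spH: "strong_critical_partition (with_proj H) {1..l} Y \<longleftrightarrow>
      (\<Union>(Y ` {1..l}) = pverts H \<and> disjoint_family_on Y {1..l}) \<and>
      (\<forall>j\<in>{1..l}. critical (parcs H) (pverts H) (Y j))"
    by (rule strong_critical_partition_iff[OF H.pair_wf_digraph_axioms]) (use assms(7) in blast)
  have ne: "case_sum X Y s \<noteq> {}" if "s \<in> {1..k} <+> {2..l}" for s
    using that X(1) Y(1) by auto
  have partC: "\<Union>(case_sum X Y ` ({1..k} <+> {2..l})) = pverts ?C \<and>
      disjoint_family_on (case_sum X Y) ({1..k} <+> {2..l}) \<longleftrightarrow> ?part"
    unfolding C(1) idx by (rule partition_Plus_iff[OF assms(3) X(2) Y(2)]) auto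
  have ballC: "(\<forall>s\<in>{1..k} <+> {2..l}. P (case_sum X Y s)) \<longleftrightarrow>
      (\<forall>i\<in>{1..k}. P (X i)) \<and> (\<forall>j\<in>{2..l}. P (Y j))" for P
    by (simp add: Plus_def ball_Un)
  have "strong_critical_partition (with_proj ?C) ({1..k} <+> {2..l}) (case_sum X Y) \<longleftrightarrow>
      (\<Union>(case_sum X Y ` ({1..k} <+> {2..l})) = pverts ?C \<and>
        disjoint_family_on (case_sum X Y) ({1..k} <+> {2..l})) \<and>
      (\<forall>s\<in>{1..k} <+> {2..l}. critical (parcs ?C) (pverts ?C) (case_sum X Y s))"
    by (rule strong_critical_partition_iff[OF wfC ne])
  then have spC: "strong_critical_partition (with_proj ?C) ({1..k} <+> {2..l}) (case_sum X Y) \<longleftrightarrow>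
      ?part \<and> (\<forall>i\<in>{1..k}. critical (?E \<union> F) (?A \<union> B) (X i)) \<and>
      (\<forall>j\<in>{2..l}. critical (?E \<union> F) (?A \<union> B) (Y j))"
    unfolding partC ballC unfolding AB C(2) .

  \<comment> \<open>\<open>f\<close> is an isomorphism from \<open>H\<close> to the graph \<open>F\<close> on \<open>B\<close>\<close>
  have critH: "critical F B (f ` S) \<longleftrightarrow> critical (parcs H) (pverts H) S" if "S \<subseteq> pverts H" for S
    unfolding F_def B_def by (rule critical_image[OF inj parcsH that])
  have "(\<forall>i\<in>{1..k}. critical ?E ?A (X i)) \<and> (\<forall>j\<in>{1..l}. critical (parcs H) (pverts H) (Y j)) \<longleftrightarrow>
      (\<forall>i\<in>{1..k}. critical (?E \<union> F) (?A \<union> B) (X i)) \<and> (\<forall>j\<in>{2..l}. critical (?E \<union> F) (?A \<union> B) (Y j))"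
    (is "?L \<longleftrightarrow> ?R") if part: ?part
  proof -
    have k1: "1 \<in> {1..k}" using assms(4) by simp
    have critHX: "critical F B (X 1) \<longleftrightarrow> critical (parcs H) (pverts H) (Y 1)"
      using critH[OF Y1] unfolding fY .
    have 1: "critical (?E \<union> F) (?A \<union> B) (X 1) \<longleftrightarrow>
        critical ?E ?A (X 1) \<and> critical (parcs H) (pverts H) (Y 1)"
      using critical_shared_iff unfolding shared critHX .
    \<comment> \<open>Either side of the equivalence makes \<open>X 1\<close> and \<open>Y 1\<close> critical, and this is what
      lets the other blocks be compared one by one.\<close>
    have *: "(\<forall>i\<in>{1..k}. critical (?E \<union> F) (?A \<union> B) (X i) \<longleftrightarrow> critical ?E ?A (X i)) \<and>
        (\<forall>j\<in>{2..l}. critical (?E \<union> F) (?A \<union> B) (Y j) \<longleftrightarrow> critical (parcs H) (pverts H) (Y j))"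
      if cG: "critical ?E ?A (X 1)" and cH: "critical (parcs H) (pverts H) (Y 1)"
    proof (intro conjI ballI)
      have cF: "critical F B (?A \<inter> B)" using cH unfolding shared critHX .
      fix i assume i: "i \<in> {1..k}"
      show "critical (?E \<union> F) (?A \<union> B) (X i) \<longleftrightarrow> critical ?E ?A (X i)"
      proof (cases "i = 1")
        case True
        show ?thesis unfolding True 1 using cG cH by blast
      next
        case False
        then have "X i \<inter> X 1 = {}" using part disjoint_family_onD[of X "{1..k}" i 1] i k1 by blast
        then have "X i \<inter> B = {}" using shared X(2)[OF i] by blast
        then show ?thesis by (rule critical_left_iff[OF cF X(2)[OF i]])
      qed
    next
      have cE: "critical ?E ?A (?A \<inter> B)" using cG unfolding shared .
      fix j assume j: "j \<in> {2..l}"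
      then have Yj: "Y j \<subseteq> pverts H" using Y(2) by blast
      have "disjoint_family_on Y (insert 1 {2..l})" using part unfolding idx by blast
      then have disj: "Y j \<inter> Y 1 = {}" using j disjoint_family_onD[of Y _ j 1] by auto
      have "critical F B (Y j) \<longleftrightarrow> critical (parcs H) (pverts H) (Y j)"
        using critH[OF Yj] unfolding f_fix[OF disj] .
      moreover have "critical (?E \<union> F) (?A \<union> B) (Y j) \<longleftrightarrow> critical F B (Y j)"
      proof (rule critical_right_iff[OF cE])
        show "Y j \<subseteq> B" unfolding B using Yj disj by blast
        show "Y j \<inter> ?A = {}" using Yj assms(3) by blast
      qed
      ultimately show "critical (?E \<union> F) (?A \<union> B) (Y j) \<longleftrightarrow> critical (parcs H) (pverts H) (Y j)"
        by blast
    qed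
    show ?thesis
    proof
      assume L: ?L
      then have "critical ?E ?A (X 1)" "critical (parcs H) (pverts H) (Y 1)"
        using k1 unfolding idx by blast+
      from *[OF this] show ?R using L unfolding idx by blast
    next
      assume R: ?R
      then have c: "critical ?E ?A (X 1)" "critical (parcs H) (pverts H) (Y 1)" using 1 k1 by blast+
      from *[OF this] show ?L using R c(2) unfolding idx by blast
    qed
  qed
  then show ?thesis unfolding spG spH spC by argo
qed

end
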